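(* For every fixed integer $k\ge0$, \[ \mathbb P\{N_I(L)=k\}=\exp\{-L\,J_I(0)+D_I(-1)\}\,\frac{(L\kappa_I)^k}{k!}\,(1+o(1)),\qquad L\to\infty. \]
   Context: Let $Z_{\mathbb H}$ be the determinantal point process on $\mathbb H=\{z\in\mathbb C:\operatorname{Im}z>0\}$ with correlation kernel $K_{\mathbb H}(z,w)=-\frac{1}{\pi(z-\overline w)^2}$ with respect to planar Lebesgue measure. Fix $I=[\alpha,\beta]$ with $0<\alpha<\beta<\infty$. For $L>0$ let $N_I(L)=\#\bigl(Z_{\mathbb H}\cap([0,L]\times I)\bigr)$, where $[0,L]\times I=\{x+\mathrm iy:0\le x\le L,\ \alpha\le y\le\beta\}$. For $\xi>0$ put $q_I(\xi)=e^{-2\alpha\xi}-e^{-2\beta\xi}$, $\rho_I=\sup_{\xi>0}q_I(\xi)\in(0,1)$, and $\Omega_I=\mathbb C\setminus(-\infty,-\rho_I^{-1}]$ (so $-1\in\Omega_I$). For $t\in\Omega_I$ define \[ \mathcal L_I(t)=\frac1{2\pi}\int_0^\infty\log\bigl(1+tq_I(\xi)\bigr)\,\mathrm d\xi, \] where for each $\xi$ the logarithm is the branch, holomorphic in $t\in\Omega_I$, that vanishes at $t=0$. The function $D_I$ is the unique holomorphic function on $\Omega_I$ with $D_I(0)=0$ such that $\log\mathbb E(1+t)^{N_I(L)}=L\mathcal L_I(t)+D_I(t)+o(1)$ as $L\to\infty$, locally uniformly on $\Omega_I$; here $t\mapsto\mathbb E(1+t)^{N_I(L)}$ is zero-free on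 $\Omega_I$ and the logarithm is its holomorphic branch vanishing at $t=0$ (convention $0^0=1$). $D_I$ is real-valued on $(-\rho_I^{-1},\infty)$. Finally, \[ J_I(0)=-\mathcal L_I(-1)=-\frac1{2\pi}\int_0^\infty\log(1-q_I(\xi))\,\mathrm d\xi,\qquad \kappa_I=\frac1{2\pi}\int_0^\infty\frac{q_I(\xi)}{1-q_I(\xi)}\,\mathrm d\xi>0. \] *)

theory Defs
  imports
    "HOL-Complex_Analysis.Complex_Analysis"
    "HOL-Probability.Probability"
    "HOL-Library.Landau_Symbols"
    "Jordan_Normal_Form.Determinant"
begin

definition upper_half_plane :: "complex set" where
  "upper_half_plane = {z. Im z > 0}"

definition K_H :: "complex \<Rightarrow> complex \<Rightarrow> complex" where
  "K_H z w = - 1 / (of_real pi * (z - cnj w)\<^sup>2)"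

text \<open>A simple point process on an open set \<open>S\<close> is represented by its random set of points.\<close>

definition simple_point_process ::
    "complex set \<Rightarrow> 'w measure \<Rightarrow> ('w \<Rightarrow> complex set) \<Rightarrow> bool" where
  "simple_point_process S M Z \<longleftrightarrow>
     prob_space M \<and>
     (\<forall>\<omega>\<in>space M. Z \<omega> \<subseteq> S \<and> (\<forall>C. compact C \<and> C \<subseteq> S \<longrightarrow> finite (Z \<omega> \<inter> C))) \<and>
     (\<forall>B\<in>sets borel. compact (closure B) \<and> closure B \<subseteq> S \<longrightarrow>
        (\<lambda>\<omega>. card (Z \<omega> \<inter> B)) \<in> measurable M (count_space UNIV))"

text \<open>
  For every \<open>n\<close>, the \<open>n\<close>-th factorial moment measure (the expected number of \<open>n\<close>-tuples of
  pairwise distinct points of the process in \<open>A \<subseteq> S\<^sup>n\<close>) has density \<open>det (K z\<^sub>i z\<^sub>j)\<close> with respect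
  to \<open>2n\<close>-dimensional Lebesgue measure. A tuple is an extensional function on \<open>{..<n}\<close>.
  The definition is meant for Hermitian positive semidefinite kernels such as \<open>K_H\<close>, whose
  determinants are real and nonnegative, so that \<open>Re\<close> and \<open>ennreal\<close> lose nothing.
\<close>

definition determinantal_process ::
    "complex set \<Rightarrow> (complex \<Rightarrow> complex \<Rightarrow> complex) \<Rightarrow> 'w measure \<Rightarrow> ('w \<Rightarrow> complex set) \<Rightarrow> bool" where
  "determinantal_process S K M Z \<longleftrightarrow>
     simple_point_process S M Z \<and>
     (\<forall>n. \<forall>A\<in>sets (Pi\<^sub>M {..<n} (\<lambda>_. lborel)). A \<subseteq> ({..<n} \<rightarrow>\<^sub>E S) \<longrightarrow>
        (\<integral>\<^sup>+\<omega>. emeasure (count_space UNIV) {z\<in>A. inj_on z {..<n} \<and> z ` {..<n} \<subseteq> Z \<omega>} \<partial>M) =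
        (\<integral>\<^sup>+z\<in>A. ennreal (Re (Determinant.det (Matrix.mat n n (\<lambda>(i, j). K (z i) (z j)))))
           \<partial>Pi\<^sub>M {..<n} (\<lambda>_. lborel)))"

definition N_I :: "real \<Rightarrow> real \<Rightarrow> ('w \<Rightarrow> complex set) \<Rightarrow> real \<Rightarrow> 'w \<Rightarrow> nat" where
  "N_I \<alpha> \<beta> Z L \<omega> = card (Z \<omega> \<inter> {z. 0 \<le> Re z \<and> Re z \<le> L \<and> \<alpha> \<le> Im z \<and> Im z \<le> \<beta>})"

definition q_I :: "real \<Rightarrow> real \<Rightarrow> real \<Rightarrow> real" where
  "q_I \<alpha> \<beta> \<xi> = exp (- 2 * \<alpha> * \<xi>) - exp (- 2 * \<beta> * \<xi>)"

definition rho_I :: "real \<Rightarrow> real \<Rightarrow> real" where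
  "rho_I \<alpha> \<beta> = (SUP \<xi>\<in>{0<..}. q_I \<alpha> \<beta> \<xi>)"

definition Omega_I :: "real \<Rightarrow> real \<Rightarrow> complex set" where
  "Omega_I \<alpha> \<beta> = UNIV - complex_of_real ` {.. - (1 / rho_I \<alpha> \<beta>)}"

text \<open>
  For \<open>t \<in> Omega_I \<alpha> \<beta>\<close> and \<open>\<xi> > 0\<close>, \<open>1 + t q(\<xi>)\<close> avoids \<open>(-\<infinity>, 0]\<close> because \<open>0 < q(\<xi>) \<le> \<rho>\<close>; hence the
  principal logarithm is the branch that is holomorphic in \<open>t\<close> and vanishes at \<open>t = 0\<close>.
\<close>

definition L_I :: "real \<Rightarrow> real \<Rightarrow> complex \<Rightarrow> complex" where
  "L_I \<alpha> \<beta> t = 1 / (2 * of_real pi) *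
     (LINT \<xi>:{0<..}|lborel. Ln (1 + t * of_real (q_I \<alpha> \<beta> \<xi>)))"

definition J_I0 :: "real \<Rightarrow> real \<Rightarrow> real" where
  "J_I0 \<alpha> \<beta> = - (1 / (2 * pi)) * (LINT \<xi>:{0<..}|lborel. ln (1 - q_I \<alpha> \<beta> \<xi>))"

definition kappa_I :: "real \<Rightarrow> real \<Rightarrow> real" where
  "kappa_I \<alpha> \<beta> = 1 / (2 * pi) * (LINT \<xi>:{0<..}|lborel. q_I \<alpha> \<beta> \<xi> / (1 - q_I \<alpha> \<beta> \<xi>))"

definition gen_fun :: "real \<Rightarrow> real \<Rightarrow> 'w measure \<Rightarrow> ('w \<Rightarrow> complex set) \<Rightarrow> real \<Rightarrow> complex \<Rightarrow> complex" where
  "gen_fun \<alpha> \<beta> M Z L t = (LINT \<omega>|M. (1 + t) ^ N_I \<alpha> \<beta> Z L \<omega>)"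

definition log_branch_on :: "complex set \<Rightarrow> (complex \<Rightarrow> complex) \<Rightarrow> (complex \<Rightarrow> complex) \<Rightarrow> bool" where
  "log_branch_on U f g \<longleftrightarrow> g holomorphic_on U \<and> g 0 = 0 \<and> (\<forall>t\<in>U. exp (g t) = f t)"

text \<open>
  \<open>D\<close> is (on \<open>Omega_I \<alpha> \<beta>\<close>) the second-order term of the logarithmic generating function. It is
  determined by this property on the connected set \<open>Omega_I \<alpha> \<beta>\<close>. Locally uniform convergence on
  this open set is uniform convergence on its compact subsets.
\<close>

definition is_D_I ::
    "real \<Rightarrow> real \<Rightarrow> 'w measure \<Rightarrow> ('w \<Rightarrow> complex set) \<Rightarrow> (complex \<Rightarrow> complex) \<Rightarrow> bool" where
  "is_D_I \<alpha> \<beta> M Z D \<longleftrightarrow>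
     D holomorphic_on Omega_I \<alpha> \<beta> \<and> D 0 = 0 \<and>
     (\<exists>logE :: real \<Rightarrow> complex \<Rightarrow> complex.
        (\<forall>L>0. log_branch_on (Omega_I \<alpha> \<beta>) (gen_fun \<alpha> \<beta> M Z L) (logE L)) \<and>
        (\<forall>C. compact C \<and> C \<subseteq> Omega_I \<alpha> \<beta> \<longrightarrow>
           uniform_limit C (\<lambda>L t. logE L t - of_real L * L_I \<alpha> \<beta> t) D at_top))"

end

theory Submission
  imports Defs
begin

text \<open>
  Write \<open>s = 1 + t\<close>. Then \<open>\<P>(N = n)\<close> is the \<open>n\<close>-th Taylor coefficient at \<open>s = 0\<close> of the probability
  generating function \<open>E s\<^sup>N\<close>, and \<open>s = 0\<close> is the interior point \<open>t = -1\<close> of \<open>Omega_I\<close>: the supremum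
  \<open>\<rho>\<close> is smaller than \<open>1\<close>, so the cut \<open>(-\<infinity>, -1/\<rho>]\<close> stays away from \<open>-1\<close>. Near this point the
  asymptotics that characterise \<open>D\<close> give, with \<open>\<Lambda>(s) = L_I (s - 1)\<close>,
  \<open>E s\<^sup>N = exp (L \<Lambda>(s) + D(s - 1) + o(1))\<close> uniformly in \<open>s\<close>.

  The right scale is \<open>s = u / L\<close>. There \<open>L \<Lambda>(u/L) = L \<Lambda>(0) + \<Lambda>'(0) u + o(1)\<close> and
  \<open>D(u/L - 1) = D(-1) + o(1)\<close>, so that \<open>exp (- L \<Lambda>(0) - D(-1)) E (u/L)\<^sup>N\<close> tends to
  \<open>exp (\<Lambda>'(0) u)\<close>, uniformly on the unit disc (\<open>rescaled_log_uniform_limit\<close>). Uniform limits of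
  holomorphic functions commute with taking Taylor coefficients, hence
  \<open>exp (- L \<Lambda>(0) - D(-1)) \<P>(N = k) / L\<^sup>k\<close> tends to \<open>\<Lambda>'(0)\<^sup>k / k!\<close>
  (\<open>poisson_coefficient_limit\<close>). This is the Poisson weight in the theorem once
  \<open>\<Lambda>(0) = - J_I0\<close> and \<open>\<Lambda>'(0) = kappa_I > 0\<close> are known. The derivative comes from expanding the
  logarithm under the integral sign (\<open>log_integral_has_derivative\<close>), which is legitimate because \<open>q\<close>
  is integrable and bounded away from \<open>1\<close>.
\<close>

section \<open>Taylor coefficients of rescaled generating functions\<close>

lemma probability_generating_function_sums:
  fixes N :: "'w \<Rightarrow> nat" and s :: complex
  assumes "prob_space M" and meas: "N \<in> measurable M (count_space UNIV)" and s: "norm s < 1"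
  shows "(\<lambda>n. complex_of_real (measure M {\<omega> \<in> space M. N \<omega> = n}) * s ^ n)
           sums (LINT \<omega>|M. s ^ N \<omega>)"
proof -
  interpret prob_space M by fact
  note meas[measurable]
  \<comment> \<open>Decompose \<open>s ^ N\<close> over the events \<open>N = n\<close> and integrate term by term; the integrals of the
      norms are dominated by a geometric series.\<close>
  define f where "f = (\<lambda>n \<omega>. indicator {\<omega> \<in> space M. N \<omega> = n} \<omega> *\<^sub>R s ^ n)"
  have ev: "{\<omega> \<in> space M. N \<omega> = n} \<in> sets M" for n
    by measurable
  have int: "integrable M (f n)" for n
    unfolding f_def using ev by (simp add: less_top[symmetric])
  have val: "integral\<^sup>L M (f n) = complex_of_real (measure M {\<omega> \<in> space M. N \<omega> = n}) * s ^ n" for n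
    unfolding f_def using ev by (subst integral_scaleR_left) (auto simp: scaleR_conv_of_real less_top[symmetric])
  have norm_val: "(LINT \<omega>|M. norm (f n \<omega>)) = measure M {\<omega> \<in> space M. N \<omega> = n} * norm s ^ n" for n
    unfolding f_def using ev by (simp add: norm_power)
  have single: "(\<lambda>n. f n \<omega>) sums s ^ N \<omega>" "summable (\<lambda>n. norm (f n \<omega>))"
    if "\<omega> \<in> space M" for \<omega>
  proof -
    have eq: "f n \<omega> = (if n = N \<omega> then s ^ n else 0)" for n
      using that by (auto simp: f_def)
    show "(\<lambda>n. f n \<omega>) sums s ^ N \<omega>"
      unfolding eq using sums_single[of "N \<omega>" "\<lambda>n. s ^ n"] by simp
    show "summable (\<lambda>n. norm (f n \<omega>))"
      by (rule summable_finite[of "{N \<omega>}"]) (auto simp: eq)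
  qed
  have "summable (\<lambda>n. LINT \<omega>|M. norm (f n \<omega>))"
  proof (rule summable_comparison_test')
    show "summable (\<lambda>n. norm s ^ n)" using s by (simp add: summable_geometric)
    show "norm (LINT \<omega>|M. norm (f n \<omega>)) \<le> norm s ^ n" for n
      unfolding norm_val by (simp add: abs_mult mult_left_le_one_le)
  qed
  then have "(\<lambda>n. integral\<^sup>L M (f n)) sums (LINT \<omega>|M. (\<Sum>n. f n \<omega>))"
    by (intro sums_integral int AE_I2 single)
  also have "(LINT \<omega>|M. (\<Sum>n. f n \<omega>)) = (LINT \<omega>|M. s ^ N \<omega>)"
    by (intro Bochner_Integration.integral_cong) (auto simp: sums_unique[OF single(1)])
  finally show ?thesis unfolding val .
qed

text \<open>
  Zooming in by the factor \<open>L\<close> linearises the exponent: the remainder of the first-order expansion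
  of \<open>\<Lambda>\<close> at \<open>u / L\<close> is \<open>o(\<bar>u\<bar> / L)\<close>, which is still \<open>o(1)\<close> after multiplication by \<open>L\<close>, while \<open>D\<close>
  contributes only its value at \<open>0\<close>.
\<close>

lemma rescaled_log_uniform_limit:
  fixes l :: "real \<Rightarrow> complex \<Rightarrow> complex" and \<Lambda> D :: "complex \<Rightarrow> complex"
  assumes "r > 0"
    and lim: "uniform_limit (cball 0 r) (\<lambda>L s. l L s - of_real L * \<Lambda> s) D at_top"
    and deriv: "(\<Lambda> has_field_derivative \<kappa>) (at 0)"
    and cont: "isCont D 0"
  shows "uniform_limit (cball 0 1) (\<lambda>L u. l L (u / of_real L) - of_real L * \<Lambda> 0 - D 0) (\<lambda>u. \<kappa> * u) at_top"
proof (rule uniform_limitI)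
  fix e :: real assume "e > 0"
  then have e3: "e / 3 > 0" by simp
  obtain d1 where d1: "d1 > 0" "\<And>s. norm s < d1 \<Longrightarrow> norm (\<Lambda> s - \<Lambda> 0 - \<kappa> * s) \<le> e / 3 * norm s"
    using deriv e3 unfolding has_field_derivative_def has_derivative_at_alt by fastforce
  obtain d2 where d2: "d2 > 0" "\<And>s. norm s < d2 \<Longrightarrow> norm (D s - D 0) < e / 3"
    using cont e3 unfolding continuous_at_eps_delta dist_norm by (metis diff_zero)
  define d where "d = min r (min d1 d2)"
  have "d > 0" using d1 d2 \<open>r > 0\<close> by (simp add: d_def)
  show "\<forall>\<^sub>F L in at_top. \<forall>u\<in>cball 0 1.
      dist (l L (u / of_real L) - of_real L * \<Lambda> 0 - D 0) (\<kappa> * u) < e"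
    using uniform_limitD[OF lim e3] eventually_gt_at_top[of "1 / d"]
  proof eventually_elim
    case (elim L)
    have "0 < 1 / d" using \<open>d > 0\<close> by simp
    then have "L > 0" using elim(2) by linarith
    show ?case
    proof
      fix u :: complex assume "u \<in> cball 0 1"
      then have u: "norm u \<le> 1" by simp
      define s where "s = u / of_real L"
      have us: "u = of_real L * s" using \<open>L > 0\<close> by (simp add: s_def)
      have nu: "norm u = L * norm s" unfolding us norm_mult using \<open>L > 0\<close> by simp
      have "norm s \<le> 1 / L" using u \<open>L > 0\<close> by (simp add: s_def norm_divide divide_right_mono)
      also have "\<dots> < d" using elim(2) \<open>d > 0\<close> \<open>L > 0\<close> by (simp add: field_simps)
      finally have "norm s < d" .
      then have s: "norm s < d1" "norm s < d2" "s \<in> cball 0 r" by (auto simp: d_def)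
      have "norm (l L s - of_real L * \<Lambda> s - D s) < e / 3"
        using elim(1) s(3) by (auto simp: dist_norm)
      moreover have "norm (of_real L * (\<Lambda> s - \<Lambda> 0 - \<kappa> * s)) \<le> e / 3"
      proof -
        have "norm (of_real L * (\<Lambda> s - \<Lambda> 0 - \<kappa> * s)) \<le> L * (e / 3 * norm s)"
          using \<open>L > 0\<close> d1(2)[OF s(1)] by (simp add: norm_mult)
        also have "\<dots> = e / 3 * norm u" by (simp add: nu)
        also have "\<dots> \<le> e / 3" using u e3 by (intro mult_left_le) auto
        finally show ?thesis .
      qed
      moreover have "norm (D s - D 0) < e / 3" by (rule d2(2)[OF s(2)])
      \<comment> \<open>The three errors come from the assumed limit, from linearising \<open>\<Lambda>\<close> and from freezing \<open>D\<close>.\<close>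
      ultimately have "norm ((l L s - of_real L * \<Lambda> s - D s) + of_real L * (\<Lambda> s - \<Lambda> 0 - \<kappa> * s)
          + (D s - D 0)) < e"
        by (intro norm_triangle_lt le_less_trans[OF add_right_mono[OF norm_triangle_ineq]]) linarith
      also have "(l L s - of_real L * \<Lambda> s - D s) + of_real L * (\<Lambda> s - \<Lambda> 0 - \<kappa> * s) + (D s - D 0) =
          (l L s - of_real L * \<Lambda> 0 - D 0) - \<kappa> * u"
        by (simp add: us algebra_simps)
      finally have "norm ((l L s - of_real L * \<Lambda> 0 - D 0) - \<kappa> * u) < e" .
      then show "dist (l L (u / of_real L) - of_real L * \<Lambda> 0 - D 0) (\<kappa> * u) < e"
        by (simp add: dist_norm s_def)
    qed
  qed
qed

text \<open>
  By Cauchy's integral formula every derivative at \<open>0\<close> is continuous under uniform convergence of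
  holomorphic functions on a disc.
\<close>

lemma power_series_coefficient_limit:
  fixes F :: "'a \<Rightarrow> complex \<Rightarrow> complex" and a :: "'a \<Rightarrow> nat \<Rightarrow> complex"
  assumes "A \<noteq> bot"
    and series: "\<forall>\<^sub>F x in A. \<forall>u\<in>ball 0 1. (\<lambda>n. a x n * u ^ n) sums F x u"
    and lim: "uniform_limit (ball 0 1) F G A"
    and G: "G has_fps_expansion g"
  shows "((\<lambda>x. a x k) \<longlongrightarrow> fps_nth g k) A"
proof -
  have "\<forall>\<^sub>F x in A. F x holomorphic_on ball 0 1"
    using series
  proof eventually_elim
    case (elim x)
    then show ?case by (intro power_series_holomorphic[of 0 1 "a x"]) simp
  qed
  then have "((\<lambda>x. (deriv ^^ k) (F x) 0 / fact k) \<longlongrightarrow> (deriv ^^ k) G 0 / fact k) A"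
    by (intro tendsto_divide higher_deriv_complex_uniform_limit[OF lim] assms) auto
  moreover have "\<forall>\<^sub>F x in A. (deriv ^^ k) (F x) 0 / fact k = a x k"
    using series
  proof eventually_elim
    case (elim x)
    then have "F x has_fps_expansion Abs_fps (a x)"
      by (intro has_fps_expansionI eventually_nhds_in_open[THEN eventually_mono, of "ball 0 1"]) auto
    then show ?case by (simp flip: fps_nth_fps_expansion)
  qed
  ultimately show ?thesis
    unfolding fps_nth_fps_expansion[OF G] by (rule Lim_transform_eventually)
qed

text \<open>
  The limit is a Poisson weight up to normalisation because the rescaled generating functions
  converge to \<open>exp (\<kappa> u)\<close>. The substitution \<open>s = u / L\<close> multiplies the \<open>n\<close>-th coefficient by
  \<open>L ^ (-n)\<close>, and for large \<open>L\<close> it maps the unit disc into the discs in which the power series and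
  the logarithm are available.
\<close>

lemma poisson_coefficient_limit:
  fixes p :: "real \<Rightarrow> nat \<Rightarrow> complex" and G l :: "real \<Rightarrow> complex \<Rightarrow> complex"
    and \<Lambda> D :: "complex \<Rightarrow> complex"
  assumes "r > 0"
    and series: "\<And>L s. L > 0 \<Longrightarrow> norm s < 1 \<Longrightarrow> (\<lambda>n. p L n * s ^ n) sums G L s"
    and log: "\<And>L s. L > 0 \<Longrightarrow> norm s \<le> r \<Longrightarrow> exp (l L s) = G L s"
    and lim: "uniform_limit (cball 0 r) (\<lambda>L s. l L s - of_real L * \<Lambda> s) D at_top"
    and deriv: "(\<Lambda> has_field_derivative \<kappa>) (at 0)"
    and cont: "isCont D 0"
  shows "((\<lambda>L. p L k * exp (- of_real L * \<Lambda> 0 - D 0) / of_real L ^ k) \<longlongrightarrow> \<kappa> ^ k / fact k) at_top"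
proof -
  define h where "h = (\<lambda>L u. l L (u / of_real L) - of_real L * \<Lambda> 0 - D 0)"
  have h: "uniform_limit (cball 0 1) h (\<lambda>u. \<kappa> * u) at_top"
    unfolding h_def by (rule rescaled_log_uniform_limit[OF assms(1) lim deriv cont])
  \<comment> \<open>The exponential is uniformly continuous only on bounded sets; the values of \<open>h\<close> eventually lie
      in a disc of radius \<open>norm \<kappa> + 1\<close>.\<close>
  have "uniform_limit (cball 0 1) (\<lambda>L u. exp (h L u)) (\<lambda>u. exp (\<kappa> * u)) at_top"
  proof (rule uniform_limit_compose_uniformly_continuous_on[OF h])
    show "uniformly_continuous_on (cball 0 (norm \<kappa> + 1)) (exp :: complex \<Rightarrow> complex)"
      by (intro compact_uniformly_continuous continuous_intros compact_cball)
    show "\<forall>\<^sub>F L in at_top. \<forall>u\<in>cball 0 1. h L u \<in> cball 0 (norm \<kappa> + 1)"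
      using uniform_limitD[OF h, of 1]
    proof (rule eventually_mono)
      fix L assume elim: "\<forall>u\<in>cball 0 1. dist (h L u) (\<kappa> * u) < 1"
      show "\<forall>u\<in>cball 0 1. h L u \<in> cball 0 (norm \<kappa> + 1)"
      proof
        fix u :: complex assume u: "u \<in> cball 0 1"
        then have "norm (\<kappa> * u) \<le> norm \<kappa>" by (simp add: norm_mult mult_left_le)
        moreover have "norm (h L u - \<kappa> * u) < 1" using elim u by (auto simp: dist_norm)
        ultimately show "h L u \<in> cball 0 (norm \<kappa> + 1)" by (simp, norm)
      qed
    qed simp
  qed auto
  then have expo: "uniform_limit (ball 0 1) (\<lambda>L u. exp (h L u)) (\<lambda>u. exp (\<kappa> * u)) at_top"
    by (rule uniform_limit_on_subset) auto
  define c where "c = (\<lambda>L. exp (- of_real L * \<Lambda> 0 - D 0))"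
  have "\<forall>\<^sub>F L in at_top. \<forall>u\<in>ball 0 1. (\<lambda>n. p L n * c L / of_real L ^ n * u ^ n) sums exp (h L u)"
    using eventually_gt_at_top[of "max 1 (1 / r)"]
  proof eventually_elim
    case (elim L)
    then have L: "L > 1" "1 / L < r" using \<open>r > 0\<close> by (auto simp: field_simps)
    show ?case
    proof
      fix u :: complex assume "u \<in> ball 0 1"
      then have u: "norm u < 1" by simp
      define s where "s = u / of_real L"
      have "norm s \<le> 1 / L" using u L by (simp add: s_def norm_divide divide_right_mono)
      moreover have "1 / L < 1" using L by simp
      ultimately have s: "norm s < 1" "norm s \<le> r" using L by linarith+
      have "exp (h L u) = G L s * c L"
        using L log[of L s] s
        by (simp add: h_def c_def exp_diff exp_minus exp_add field_simps flip: s_def)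
      moreover have "(\<lambda>n. p L n * s ^ n * c L) sums (G L s * c L)"
        using L s by (intro sums_mult2 series) auto
      ultimately show "(\<lambda>n. p L n * c L / of_real L ^ n * u ^ n) sums exp (h L u)"
        by (simp add: s_def power_divide mult_ac)
    qed
  qed
  from power_series_coefficient_limit[OF _ this expo has_fps_expansion_exp, of k]
  show ?thesis by (simp add: c_def)
qed

section \<open>Expansion of the logarithmic integral at minus one\<close>

lemma integrable_div_one_minus:
  fixes q :: "'a \<Rightarrow> real"
  assumes int: "integrable M q" and q: "\<And>x. 0 \<le> q x" "\<And>x. q x \<le> c" and c: "c < 1"
  shows "integrable M (\<lambda>x. q x / (1 - q x))"
proof (rule Bochner_Integration.integrable_bound[of M "\<lambda>x. q x / (1 - c)"])
  show "AE x in M. norm (q x / (1 - q x)) \<le> norm (q x / (1 - c))"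
  proof (rule AE_I2)
    fix x
    have "1 - c \<le> 1 - q x" "0 < 1 - c" using q(2)[of x] c by auto
    then have "0 \<le> q x / (1 - q x)" "q x / (1 - q x) \<le> q x / (1 - c)"
      using q(1)[of x] by (auto intro!: divide_left_mono)
    then show "norm (q x / (1 - q x)) \<le> norm (q x / (1 - c))"
      unfolding real_norm_def by linarith
  qed
qed (use int in auto)

text \<open>
  With \<open>w = q / (1 - q)\<close> one has \<open>1 + (s - 1) q = (1 - q) (1 + s w)\<close>, so the integrand is
  \<open>ln (1 - q) + s w\<close> up to an error \<open>R s\<close>. Since \<open>w\<close> is bounded by \<open>1 / b\<close>, where \<open>b = 1 - c\<close>,
  the error is at most \<open>2 \<bar>s\<bar>\<^sup>2 w / b\<close> for \<open>\<bar>s\<bar> \<le> b / 2\<close>, which is integrable and of second order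
  in \<open>s\<close>.
\<close>

lemma log_integral_has_derivative:
  fixes q :: "'a \<Rightarrow> real"
  assumes int: "integrable M q" and q: "\<And>x. 0 \<le> q x" "\<And>x. q x \<le> c" and c: "c < 1"
  shows "((\<lambda>s. LINT x|M. Ln (1 + (s - 1) * of_real (q x)))
          has_field_derivative of_real (LINT x|M. q x / (1 - q x))) (at 0)"
proof -
  have [measurable]: "q \<in> borel_measurable M" using int by simp
  define b where "b = 1 - c"
  have b: "b > 0" "\<And>x. b \<le> 1 - q x" using c q by (auto simp: b_def)
  have pos: "1 - q x > 0" for x using b(1) b(2)[of x] by linarith
  define w where "w = (\<lambda>x. q x / (1 - q x))"
  have [measurable]: "w \<in> borel_measurable M" unfolding w_def by measurable
  have w: "0 \<le> w x" "w x \<le> 1 / b" for x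
  proof -
    show "0 \<le> w x" using q(1)[of x] pos[of x] by (simp add: w_def)
    show "w x \<le> 1 / b"
      unfolding w_def using q(1)[of x] pos[of x] b by (intro frac_le) auto
  qed
  have int_w: "integrable M w"
    unfolding w_def using integrable_div_one_minus[OF assms] .
  have inverse_w: "1 - q x = inverse (1 + w x)" for x
    using pos[of x] by (simp add: w_def field_simps)
  have int_ln: "integrable M (\<lambda>x. ln (1 - q x))"
  proof (rule Bochner_Integration.integrable_bound[OF int_w])
    show "AE x in M. norm (ln (1 - q x)) \<le> norm (w x)"
    proof (rule AE_I2)
      fix x
      show "norm (ln (1 - q x)) \<le> norm (w x)"
        using w(1)[of x] ln_add_one_self_le_self[of "w x"] by (simp add: inverse_w ln_inverse)
    qed
  qed simp
  have small: "norm (s * of_real (w x)) \<le> 1 / 2" if "norm s \<le> b / 2" for s :: complex and x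
  proof -
    have "norm (s * of_real (w x)) \<le> (b / 2) * (1 / b)"
      unfolding norm_mult norm_of_real using that w[of x] b by (intro mult_mono) auto
    then show ?thesis using b by simp
  qed
  define R where "R = (\<lambda>s x. Ln (1 + s * of_real (w x)) - s * of_real (w x))"
  have split: "Ln (1 + (s - 1) * of_real (q x)) = of_real (ln (1 - q x)) + s * of_real (w x) + R s x"
    if "norm s \<le> b / 2" for s x
  proof -
    have "norm (s * of_real (w x)) \<noteq> 1" using small[OF that, of x] by linarith
    then have nz: "1 + s * of_real (w x) \<noteq> 0"
      by (metis add_eq_0_iff norm_minus_cancel norm_one)
    have "q x = (1 - q x) * w x" using pos[of x] by (simp add: w_def)
    then have qw: "complex_of_real (q x) = of_real (1 - q x) * of_real (w x)"
      by (metis of_real_mult)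
    have "1 + (s - 1) * of_real (q x) = of_real (1 - q x) + s * complex_of_real (q x)"
      by (simp add: algebra_simps)
    also have "\<dots> = of_real (1 - q x) + s * (of_real (1 - q x) * of_real (w x))"
      by (subst qw) (rule refl)
    also have "\<dots> = of_real (1 - q x) * (1 + s * of_real (w x))"
      by (simp only: distrib_left mult_ac mult_1_left mult_1_right)
    finally have eq: "1 + (s - 1) * of_real (q x) = of_real (1 - q x) * (1 + s * of_real (w x))" .
    then show ?thesis unfolding eq Ln_times_of_real[OF pos nz] R_def by (simp flip: Ln_of_real[OF pos])
  qed
  have R: "norm (R s x) \<le> 2 * norm s ^ 2 / b * w x" if "norm s \<le> b / 2" for s x
  proof -
    note half = small[OF that, of x]
    then have "norm (R s x) \<le> norm (s * of_real (w x)) ^ 2 / (1 - norm (s * of_real (w x)))"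
      unfolding R_def by (intro Ln_approx_linear) linarith
    also have "\<dots> \<le> norm (s * of_real (w x)) ^ 2 / (1 / 2)"
      using half by (intro divide_left_mono mult_pos_pos) (linarith | simp)+
    also have "\<dots> = 2 * norm s ^ 2 * (w x * w x)"
      using w[of x] by (simp add: norm_mult power_mult_distrib power2_eq_square)
    also have "\<dots> \<le> 2 * norm s ^ 2 * (1 / b * w x)"
      using w[of x] by (intro mult_left_mono mult_right_mono) auto
    finally show ?thesis by simp
  qed
  have int_R: "integrable M (R s)" if "norm s \<le> b / 2" for s
  proof (rule Bochner_Integration.integrable_bound)
    show "integrable M (\<lambda>x. 2 * norm s ^ 2 / b * w x)"
      using int_w by (intro integrable_mult_right)
    show "AE x in M. norm (R s x) \<le> norm (2 * norm s ^ 2 / b * w x)"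
      by (intro AE_I2 order_trans[OF R[OF that]]) (simp only: real_norm_def abs_ge_self)
    show "R s \<in> borel_measurable M" unfolding R_def by measurable
  qed
  define \<Lambda> where "\<Lambda> = (\<lambda>s. LINT x|M. Ln (1 + (s - 1) * of_real (q x)))"
  define \<kappa> where "\<kappa> = integral\<^sup>L M w"
  have expand: "\<Lambda> s = of_real (LINT x|M. ln (1 - q x)) + s * of_real \<kappa> + integral\<^sup>L M (R s)"
    if "norm s \<le> b / 2" for s
  proof -
    have "integrable M (\<lambda>x. complex_of_real (ln (1 - q x)))"
      and "integrable M (\<lambda>x. s * complex_of_real (w x))"
      using int_ln int_w by auto
    then show ?thesis
      unfolding \<Lambda>_def \<kappa>_def split[OF that] using int_R[OF that] by simp
  qed
  have "((\<lambda>s. (\<Lambda> s - \<Lambda> 0) / (s - 0)) \<longlongrightarrow> of_real \<kappa>) (at 0)"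
  proof (subst Lim_null, rule Lim_null_comparison)
    have "\<forall>\<^sub>F s in at (0::complex). s \<in> ball 0 (b / 2) - {0}"
      using b by (intro eventually_at_in_open) auto
    then show "\<forall>\<^sub>F s in at 0. norm ((\<Lambda> s - \<Lambda> 0) / (s - 0) - of_real \<kappa>) \<le> norm s * (2 / b * \<kappa>)"
    proof eventually_elim
      case (elim s)
      then have s: "norm s \<le> b / 2" "s \<noteq> 0" by auto
      have "integral\<^sup>L M (R 0) = 0" by (simp add: R_def)
      then have "(\<Lambda> s - \<Lambda> 0) / (s - 0) - of_real \<kappa> = integral\<^sup>L M (R s) / s"
        using s expand[of s] expand[of 0] b by (simp add: field_simps)
      then have "norm ((\<Lambda> s - \<Lambda> 0) / (s - 0) - of_real \<kappa>) = norm (integral\<^sup>L M (R s)) / norm s"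
        by (simp only: norm_divide)
      also have "norm (integral\<^sup>L M (R s)) \<le> (LINT x|M. 2 * norm s ^ 2 / b * w x)"
        by (intro order_trans[OF integral_norm_bound] integral_mono integrable_norm
            integrable_mult_right int_R[OF s(1)] R[OF s(1)] int_w)
      also have "(LINT x|M. 2 * norm s ^ 2 / b * w x) / norm s = norm s * (2 / b * \<kappa>)"
        using s by (simp add: \<kappa>_def power2_eq_square)
      finally show ?case by (simp add: divide_right_mono)
    qed
    have "((\<lambda>s::complex. norm s * (2 / b * \<kappa>)) \<longlongrightarrow> norm (0::complex) * (2 / b * \<kappa>)) (at 0)"
      by (intro tendsto_intros)
    then show "((\<lambda>s::complex. norm s * (2 / b * \<kappa>)) \<longlongrightarrow> 0) (at 0)" by simp
  qed
  then show ?thesis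
    by (simp add: has_field_derivative_iff \<Lambda>_def \<kappa>_def w_def)
qed

lemma log_integral_minus_one:
  fixes q :: "'a \<Rightarrow> real"
  assumes "\<And>x. q x < 1"
  shows "(LINT x|M. Ln (1 + (0 - 1) * of_real (q x))) = complex_of_real (LINT x|M. ln (1 - q x))"
  unfolding integral_complex_of_real[symmetric]
  by (intro Bochner_Integration.integral_cong refl) (use assms in \<open>simp flip: Ln_of_real\<close>)

section \<open>The symbol of the strip and its leading term\<close>

lemma exp_has_bochner_integral:
  assumes "0 < l"
  shows "has_bochner_integral lborel (\<lambda>x. indicator {0<..} x * exp (- l * x)) (1 / l :: real)"
proof -
  have "((\<lambda>x. exp (- l * x)) has_integral 1 / l) {0..}"
    using has_integral_exp_minus_to_infinity[OF assms, of 0] by simp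
  then have "((\<lambda>x. exp (- l * x)) has_integral 1 / l) {0<..}"
    by (subst has_integral_spike_set_eq[of _ "{0..}"])
       (auto intro!: negligible_subset[OF negligible_sing[of 0]])
  then have "(\<integral>\<^sup>+x. ennreal (indicator {0<..} x * exp (- l * x)) \<partial>lborel) = ennreal (1 / l)"
    by (intro nn_integral_has_integral_lebesgue) auto
  then show ?thesis
    using assms by (intro has_bochner_integral_nn_integral) auto
qed

lemma q_I_pos:
  assumes "\<alpha> < \<beta>" "0 < \<xi>"
  shows "0 < q_I \<alpha> \<beta> \<xi>"
  using assms by (simp add: q_I_def)

text \<open>
  Near \<open>\<xi> = 0\<close> the subtracted exponential is close to \<open>1\<close>, and away from \<open>0\<close> the first exponential
  is small; the two regimes are separated at \<open>\<xi> = 1\<close>.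
\<close>

lemma q_I_bounded_away_from_1:
  assumes "0 < \<alpha>" "\<alpha> < \<beta>"
  obtains c where "c < 1" "\<And>\<xi>. 0 < \<xi> \<Longrightarrow> q_I \<alpha> \<beta> \<xi> \<le> c"
proof
  let ?c = "max (1 - exp (- 2 * \<beta>)) (exp (- 2 * \<alpha>))"
  show "?c < 1" using assms by simp
  show "q_I \<alpha> \<beta> \<xi> \<le> ?c" if "0 < \<xi>" for \<xi>
  proof (cases "\<xi> \<le> 1")
    case True
    have "exp (- 2 * \<alpha> * \<xi>) \<le> 1" using assms that by simp
    moreover have "exp (- 2 * \<beta>) \<le> exp (- 2 * \<beta> * \<xi>)"
      using assms True by simp
    ultimately show ?thesis unfolding q_I_def by linarith
  next
    case False
    then have "exp (- 2 * \<alpha> * \<xi>) \<le> exp (- 2 * \<alpha>)" using assms by simp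
    moreover have "0 < exp (- 2 * \<beta> * \<xi>)" by simp
    ultimately show ?thesis unfolding q_I_def by linarith
  qed
qed

lemma cball_minus_one_subset_Omega_I:
  assumes "0 < \<alpha>" "\<alpha> < \<beta>"
  obtains r where "0 < r" "cball (- 1) r \<subseteq> Omega_I \<alpha> \<beta>"
proof
  obtain c where c: "c < 1" "\<And>\<xi>. 0 < \<xi> \<Longrightarrow> q_I \<alpha> \<beta> \<xi> \<le> c"
    using q_I_bounded_away_from_1 assms by blast
  define \<rho> where "\<rho> = rho_I \<alpha> \<beta>"
  have "q_I \<alpha> \<beta> 1 \<le> \<rho>"
    unfolding \<rho>_def rho_I_def using c by (intro cSUP_upper bdd_aboveI2) auto
  then have "0 < \<rho>" using q_I_pos[of \<alpha> \<beta> 1] assms by simp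
  have "\<rho> \<le> c"
    unfolding \<rho>_def rho_I_def using c by (intro cSUP_least) auto
  then have "1 < 1 / \<rho>" using c(1) \<open>0 < \<rho>\<close> by simp
  then show "0 < (1 / \<rho> - 1) / 2" by simp
  show "cball (- 1) ((1 / \<rho> - 1) / 2) \<subseteq> Omega_I \<alpha> \<beta>"
  proof
    fix t assume "t \<in> cball (- 1 :: complex) ((1 / \<rho> - 1) / 2)"
    then have "norm (t + 1) \<le> (1 / \<rho> - 1) / 2" by (simp add: dist_norm norm_minus_commute)
    then have "- ((1 / \<rho> - 1) / 2) \<le> Re (t + 1)"
      using abs_Re_le_cmod[of "t + 1"] by linarith
    then have "- (1 / \<rho>) < Re t" using \<open>1 < 1 / \<rho>\<close> unfolding plus_complex.simps one_complex.simps by argo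
    then show "t \<in> Omega_I \<alpha> \<beta>" unfolding Omega_I_def \<rho>_def by auto
  qed
qed

lemma q_I_has_bochner_integral:
  assumes "0 < \<alpha>" "\<alpha> < \<beta>"
  shows "has_bochner_integral lborel (\<lambda>\<xi>. indicator {0<..} \<xi> * q_I \<alpha> \<beta> \<xi>) (1 / (2 * \<alpha>) - 1 / (2 * \<beta>))"
  using has_bochner_integral_diff[OF exp_has_bochner_integral[of "2 * \<alpha>"] exp_has_bochner_integral[of "2 * \<beta>"]] assms
  by (simp add: q_I_def right_diff_distrib)

text \<open>
  Extending \<open>q\<close> by \<open>0\<close> to the left half-line turns the set integrals into integrals over the whole
  line, because all three integrands vanish where \<open>q\<close> does. Positivity of \<open>kappa_I\<close> follows from
  \<open>q / (1 - q) \<ge> q\<close> and \<open>\<integral> q = 1 / (2 \<alpha>) - 1 / (2 \<beta>)\<close>.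
\<close>

lemma L_I_expansion_at_minus_one:
  assumes "0 < \<alpha>" "\<alpha> < \<beta>"
  shows "((\<lambda>s. L_I \<alpha> \<beta> (s - 1)) has_field_derivative of_real (kappa_I \<alpha> \<beta>)) (at 0)"
    and "L_I \<alpha> \<beta> (- 1) = of_real (- J_I0 \<alpha> \<beta>)"
    and "0 < kappa_I \<alpha> \<beta>"
proof -
  define q where "q = (\<lambda>\<xi>. indicator {0<..} \<xi> * q_I \<alpha> \<beta> \<xi>)"
  obtain c where c: "c < 1" "\<And>\<xi>. 0 < \<xi> \<Longrightarrow> q_I \<alpha> \<beta> \<xi> \<le> c"
    using q_I_bounded_away_from_1 assms by blast
  have q: "0 \<le> q \<xi>" "q \<xi> \<le> max 0 c" "q \<xi> < 1" for \<xi>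
    using c(1) c(2)[of \<xi>] q_I_pos[of \<alpha> \<beta> \<xi>] assms by (auto simp: q_def split: split_indicator)
  have q_int: "has_bochner_integral lborel q (1 / (2 * \<alpha>) - 1 / (2 * \<beta>))"
    unfolding q_def using q_I_has_bochner_integral assms .
  have int: "integrable lborel q"
    using q_int by (simp add: has_bochner_integral_iff)
  have L: "L_I \<alpha> \<beta> t = 1 / (2 * of_real pi) * (LINT \<xi>|lborel. Ln (1 + t * of_real (q \<xi>)))" for t
    unfolding L_I_def set_lebesgue_integral_def
    by (intro arg_cong2[where f = "(*)"] Bochner_Integration.integral_cong refl)
       (simp add: q_def split: split_indicator)
  have J: "J_I0 \<alpha> \<beta> = - (1 / (2 * pi)) * (LINT \<xi>|lborel. ln (1 - q \<xi>))"
    unfolding J_I0_def set_lebesgue_integral_def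
    by (intro arg_cong2[where f = "(*)"] Bochner_Integration.integral_cong refl)
       (simp add: q_def split: split_indicator)
  have K: "kappa_I \<alpha> \<beta> = 1 / (2 * pi) * (LINT \<xi>|lborel. q \<xi> / (1 - q \<xi>))"
    unfolding kappa_I_def set_lebesgue_integral_def
    by (intro arg_cong2[where f = "(*)"] Bochner_Integration.integral_cong refl)
       (simp add: q_def split: split_indicator)
  show "((\<lambda>s. L_I \<alpha> \<beta> (s - 1)) has_field_derivative of_real (kappa_I \<alpha> \<beta>)) (at 0)"
    using DERIV_cmult[OF log_integral_has_derivative[OF int q(1,2)], of "1 / (2 * of_real pi)"] c(1)
    unfolding L K by simp
  show "L_I \<alpha> \<beta> (- 1) = of_real (- J_I0 \<alpha> \<beta>)"
    using log_integral_minus_one[of q lborel] q(3) unfolding L J by simp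
  have "0 < 1 / (2 * \<alpha>) - 1 / (2 * \<beta>)" using assms by (simp add: field_simps)
  also have "\<dots> = (LINT \<xi>|lborel. q \<xi>)" using q_int by (simp add: has_bochner_integral_iff)
  also have "\<dots> \<le> (LINT \<xi>|lborel. q \<xi> / (1 - q \<xi>))"
  proof (intro integral_mono int integrable_div_one_minus[OF int q(1,2)])
    show "q \<xi> \<le> q \<xi> / (1 - q \<xi>)" for \<xi>
      using q(1,3)[of \<xi>] by (simp add: pos_le_divide_eq mult_left_le)
  qed (use c in auto)
  finally show "0 < kappa_I \<alpha> \<beta>" unfolding K by simp
qed

lemma N_I_measurable:
  assumes "simple_point_process upper_half_plane M Z" and "0 < \<alpha>"
  shows "N_I \<alpha> \<beta> Z L \<in> measurable M (count_space UNIV)"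
proof -
  let ?B = "{z. 0 \<le> Re z \<and> Re z \<le> L \<and> \<alpha> \<le> Im z \<and> Im z \<le> \<beta>}"
  have B: "?B = cbox (Complex 0 \<alpha>) (Complex L \<beta>)"
    by (auto simp: in_cbox_complex_iff)
  have "closure ?B \<subseteq> upper_half_plane" "compact (closure ?B)" "?B \<in> sets borel"
    unfolding B using assms(2) by (auto simp: upper_half_plane_def in_cbox_complex_iff)
  then show ?thesis
    using assms(1) unfolding simple_point_process_def N_I_def by blast
qed

section \<open>Asymptotics of the point probabilities\<close>

theorem theorem1p2:
  fixes \<alpha> \<beta> :: real and M :: "'w measure" and Z :: "'w \<Rightarrow> complex set"
    and D :: "complex \<Rightarrow> complex" and k :: nat
  assumes "0 < \<alpha>" and "\<alpha> < \<beta>"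
    and "determinantal_process upper_half_plane K_H M Z"
    and "is_D_I \<alpha> \<beta> M Z D"
  shows "(\<lambda>L. complex_of_real (measure M {\<omega> \<in> space M. N_I \<alpha> \<beta> Z L \<omega> = k})) \<sim>[at_top]
         (\<lambda>L. exp (complex_of_real (- L * J_I0 \<alpha> \<beta>) + D (- 1)) *
              complex_of_real ((L * kappa_I \<alpha> \<beta>) ^ k / fact k))"
proof -
  let ?p = "\<lambda>L n. complex_of_real (measure M {\<omega> \<in> space M. N_I \<alpha> \<beta> Z L \<omega> = n})"
  let ?\<kappa> = "kappa_I \<alpha> \<beta>"
  note expansion = L_I_expansion_at_minus_one[OF assms(1,2)]
  have process: "simple_point_process upper_half_plane M Z"
    using assms(3) by (simp add: determinantal_process_def)
  then have "prob_space M" by (simp add: simple_point_process_def)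
  obtain r where r: "0 < r" "cball (- 1) r \<subseteq> Omega_I \<alpha> \<beta>"
    using cball_minus_one_subset_Omega_I assms by blast
  obtain l where holo: "D holomorphic_on Omega_I \<alpha> \<beta>"
    and log: "\<And>L. L > 0 \<Longrightarrow> log_branch_on (Omega_I \<alpha> \<beta>) (gen_fun \<alpha> \<beta> M Z L) (l L)"
    and lim: "\<And>C. compact C \<Longrightarrow> C \<subseteq> Omega_I \<alpha> \<beta> \<Longrightarrow>
      uniform_limit C (\<lambda>L t. l L t - of_real L * L_I \<alpha> \<beta> t) D at_top"
    using assms(4) unfolding is_D_I_def by blast
  have shift: "(\<lambda>s. s - 1) \<in> cball 0 r \<rightarrow> cball (- 1 :: complex) r"
    by (auto simp: dist_norm norm_minus_commute)
  have "isCont D (- 1)"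
    using holomorphic_on_imp_continuous_on[OF holomorphic_on_subset[OF holo r(2)]] r(1)
    by (simp add: continuous_on_interior)
  then have cont: "isCont (\<lambda>s. D (s - 1)) 0"
    using isCont_o2[of 0 "\<lambda>s. s - 1" D] by simp
  have "((\<lambda>L. ?p L k * exp (- of_real L * L_I \<alpha> \<beta> (0 - 1) - D (0 - 1)) / of_real L ^ k)
      \<longlongrightarrow> of_real ?\<kappa> ^ k / fact k) at_top"
  proof (rule poisson_coefficient_limit[OF r(1)])
    show "(\<lambda>n. ?p L n * s ^ n) sums (LINT \<omega>|M. s ^ N_I \<alpha> \<beta> Z L \<omega>)" if "norm s < 1" for L s
      using probability_generating_function_sums N_I_measurable process \<open>prob_space M\<close> assms(1) that
      by blast
    show "exp (l L (s - 1)) = (LINT \<omega>|M. s ^ N_I \<alpha> \<beta> Z L \<omega>)" if "L > 0" "norm s \<le> r" for L s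
    proof -
      have "s - 1 \<in> Omega_I \<alpha> \<beta>" using shift r(2) that by fastforce
      then show ?thesis using log[OF that(1)] by (simp add: log_branch_on_def gen_fun_def)
    qed
    show "uniform_limit (cball 0 r) (\<lambda>L s. l L (s - 1) - of_real L * L_I \<alpha> \<beta> (s - 1)) (\<lambda>s. D (s - 1)) at_top"
      using uniform_limit_compose'[OF lim[OF compact_cball r(2)] shift] .
  qed (fact expansion(1) cont)+
  then have main: "((\<lambda>L. ?p L k * exp (- (of_real (- L * J_I0 \<alpha> \<beta>) + D (- 1))) / of_real L ^ k)
      \<longlongrightarrow> of_real ?\<kappa> ^ k / fact k) at_top"
    by (simp add: expansion(2))
  have nz: "complex_of_real ?\<kappa> ^ k / fact k \<noteq> 0" using expansion(3) by simp
  show ?thesis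
  proof (rule asymp_equivI')
    have "((\<lambda>L. ?p L k * exp (- (of_real (- L * J_I0 \<alpha> \<beta>) + D (- 1))) / of_real L ^ k / (of_real ?\<kappa> ^ k / fact k))
        \<longlongrightarrow> (of_real ?\<kappa> ^ k / fact k) / (of_real ?\<kappa> ^ k / fact k)) at_top"
      by (intro tendsto_divide main tendsto_const nz)
    moreover have "x * exp (- y) / of_real L ^ k / (of_real ?\<kappa> ^ k / fact k) =
        x / (exp y * complex_of_real ((L * ?\<kappa>) ^ k / fact k))" for x y :: complex and L
      by (simp add: exp_minus divide_inverse power_mult_distrib mult_ac)
    ultimately show "((\<lambda>L. ?p L k / (exp (of_real (- L * J_I0 \<alpha> \<beta>) + D (- 1)) *
        of_real ((L * ?\<kappa>) ^ k / fact k))) \<longlongrightarrow> 1) at_top"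
      by (simp only: divide_self[OF nz])
  qed
qed

end
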